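(* Let $(\Gamma,\preceq)$ be an ordered group, and let $(G,H)$ be a convex jump in $\Gamma$ such that $G$ is a ($\preceq$-)Conradian extension of $H$. Then, up to multiplication by a positive real number, there exists a unique nontrivial group homomorphism $\tau: G\to\mathbb{R}$ such that $\ker(\tau)=H$ and $\tau(g)>0$ for every positive element $g\in G\setminus H$.
   Context: An ordered group $(\Gamma,\preceq)$ is a group with a total order relation invariant under left multiplication; $g$ is positive if $g\succ 1$. A subset $S\subseteq\Gamma$ is $\preceq$-convex if whenever $f_1\prec f\prec f_2$ with $f_1,f_2\in S$ and $f\in\Gamma$, then $f\in S$. A convex jump is a pair $(G,H)$ of distinct $\preceq$-convex subgroups of $\Gamma$ with $H\subset G$ and such that there is no $\preceq$-convex subgroup strictly between them. If $H$ is a $\preceq$-convex subgroup of $G$, the space of left cosets $G/H$ carries the total order $\leq$ defined by: $fH<gH$ if $fH\neq gH$ and $fh_1\prec gh_2$ for some (equivalently all) $h_1,h_2\in H$. The action of $G$ on $G/H$ by left translations preserves this order. Given a group $G$ acting by order-preserving bijections on a totally ordered space $(\Omega,\leq)$, a crossing for the action is a 5-uple $(f,g,u,v,w)$ with $f,g\in G$ and $u,v,w\in\Omega$ such that: (i) $u<w<v$; (ii) $g^n u<v$ and $f^n v>u$ for every $n\in\mathbb{N}$ (positive integers); (iii) there exist $M,N\in\mathbb{N}$ with $f^N v<w<g^M u$. One says that $G$ is a $\preceq$-Conradian extension of $H$ if the action of $G$ on $G/H$ by left translations has no crossings. *)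

theory Defs
  imports Complex_Main "HOL-Algebra.Algebra"
begin

abbreviation strict :: "('a \<times> 'a) set \<Rightarrow> 'a \<Rightarrow> 'a \<Rightarrow> bool"
  where "strict r x y \<equiv> (x, y) \<in> r \<and> x \<noteq> y"

text \<open>Only left invariance is required: orders are not assumed to be bi-invariant.\<close>

locale ordered_group = group \<Gamma> for \<Gamma> (structure) +
  fixes r :: "('a \<times> 'a) set"
  assumes linear_order: "linear_order_on (carrier \<Gamma>) r"
    and left_invariant:
      "\<lbrakk>f \<in> carrier \<Gamma>; (x, y) \<in> r\<rbrakk> \<Longrightarrow> (f \<otimes> x, f \<otimes> y) \<in> r"

definition positive :: "('a, 'm) monoid_scheme \<Rightarrow> ('a \<times> 'a) set \<Rightarrow> 'a \<Rightarrow> bool"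
  where "positive \<Gamma> r g \<longleftrightarrow> strict r \<one>\<^bsub>\<Gamma>\<^esub> g"

definition order_convex :: "('a, 'm) monoid_scheme \<Rightarrow> ('a \<times> 'a) set \<Rightarrow> 'a set \<Rightarrow> bool"
  where "order_convex \<Gamma> r S \<longleftrightarrow>
    (\<forall>f1\<in>S. \<forall>f2\<in>S. \<forall>f\<in>carrier \<Gamma>. strict r f1 f \<and> strict r f f2 \<longrightarrow> f \<in> S)"

definition convex_subgroup :: "('a, 'm) monoid_scheme \<Rightarrow> ('a \<times> 'a) set \<Rightarrow> 'a set \<Rightarrow> bool"
  where "convex_subgroup \<Gamma> r H \<longleftrightarrow> subgroup H \<Gamma> \<and> order_convex \<Gamma> r H"

definition convex_jump ::
    "('a, 'm) monoid_scheme \<Rightarrow> ('a \<times> 'a) set \<Rightarrow> 'a set \<Rightarrow> 'a set \<Rightarrow> bool"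
  where "convex_jump \<Gamma> r G H \<longleftrightarrow>
    convex_subgroup \<Gamma> r G \<and> convex_subgroup \<Gamma> r H \<and> H \<subset> G \<and>
    (\<nexists>K. convex_subgroup \<Gamma> r K \<and> H \<subset> K \<and> K \<subset> G)"

locale ordered_action = group_action G \<Omega> \<phi> for G (structure) and \<Omega> and \<phi> +
  fixes r :: "('b \<times> 'b) set"
  assumes linear_order: "linear_order_on \<Omega> r"
    and order_preserving:
      "\<lbrakk>g \<in> carrier G; (x, y) \<in> r\<rbrakk> \<Longrightarrow> (\<phi> g x, \<phi> g y) \<in> r"

text \<open>The exponents range over the positive integers.\<close>

definition crossing ::
    "('a, 'm) monoid_scheme \<Rightarrow> 'b set \<Rightarrow> ('a \<Rightarrow> 'b \<Rightarrow> 'b) \<Rightarrow> ('b \<times> 'b) set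
      \<Rightarrow> 'a \<Rightarrow> 'a \<Rightarrow> 'b \<Rightarrow> 'b \<Rightarrow> 'b \<Rightarrow> bool"
  where "crossing G \<Omega> \<phi> r f g u v w \<longleftrightarrow>
    f \<in> carrier G \<and> g \<in> carrier G \<and> u \<in> \<Omega> \<and> v \<in> \<Omega> \<and> w \<in> \<Omega> \<and>
    strict r u w \<and> strict r w v \<and>
    (\<forall>n::nat. n \<ge> 1 \<longrightarrow>
      strict r (\<phi> (g [^]\<^bsub>G\<^esub> n) u) v \<and> strict r u (\<phi> (f [^]\<^bsub>G\<^esub> n) v)) \<and>
    (\<exists>(M::nat) (N::nat). M \<ge> 1 \<and> N \<ge> 1 \<and>
      strict r (\<phi> (f [^]\<^bsub>G\<^esub> N) v) w \<and> strict r w (\<phi> (g [^]\<^bsub>G\<^esub> M) u))"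

definition coset_order ::
    "('a, 'm) monoid_scheme \<Rightarrow> ('a \<times> 'a) set \<Rightarrow> 'a set \<Rightarrow> ('a set \<times> 'a set) set"
  where "coset_order G r H =
    {(A, B). A \<in> lcosets\<^bsub>G\<^esub> H \<and> B \<in> lcosets\<^bsub>G\<^esub> H \<and>
      (A = B \<or> (\<exists>a\<in>A. \<exists>b\<in>B. strict r a b))}"

text \<open>Restricted to the coset space because \<^const>\<open>BijGroup\<close> consists of extensional functions.\<close>

definition coset_action ::
    "('a, 'm) monoid_scheme \<Rightarrow> 'a set \<Rightarrow> 'a \<Rightarrow> 'a set \<Rightarrow> 'a set"
  where "coset_action G H g = (\<lambda>C\<in>lcosets\<^bsub>G\<^esub> H. g <#\<^bsub>G\<^esub> C)"

lemma ordered_group_subgroup: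
  assumes "ordered_group \<Gamma> r" "subgroup G \<Gamma>"
  shows "ordered_group (\<Gamma>\<lparr>carrier := G\<rparr>) (r \<inter> G \<times> G)"
proof -
  interpret ordered_group \<Gamma> r by fact
  interpret S: subgroup G \<Gamma> by fact
  have "group (\<Gamma>\<lparr>carrier := G\<rparr>)" using S.subgroup_is_group is_group by blast
  moreover have "linear_order_on G (r \<inter> G \<times> G)"
  proof -
    have "refl_on (carrier \<Gamma>) r" "trans r" "antisym r" "total_on (carrier \<Gamma>) r"
      using linear_order unfolding order_on_defs by auto
    then have "refl_on G (r \<inter> G \<times> G)" "trans (r \<inter> G \<times> G)" "antisym (r \<inter> G \<times> G)"
      "total_on G (r \<inter> G \<times> G)"
      using S.subset trans_Restr antisym_subset[of "r \<inter> G \<times> G" r]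
      by (fastforce simp: refl_on_def, blast, blast, simp add: total_on_def subset_iff)
    then show ?thesis unfolding order_on_defs by blast
  qed
  ultimately show ?thesis
    using left_invariant S.subset
    by (auto simp: ordered_group_def ordered_group_axioms_def)
qed

lemma (in ordered_group) strict_trans:
  "strict r x y \<Longrightarrow> strict r y z \<Longrightarrow> strict r x z"
  using linear_order unfolding order_on_defs antisym_def trans_def by metis

lemma (in ordered_group) strict_linear:
  "x \<in> carrier \<Gamma> \<Longrightarrow> y \<in> carrier \<Gamma> \<Longrightarrow> x \<noteq> y \<Longrightarrow> \<not> strict r x y \<Longrightarrow> strict r y x"
  using linear_order unfolding order_on_defs total_on_def by metis

lemma (in ordered_group) strict_left_mult:
  assumes "f \<in> carrier \<Gamma>" "strict r x y" shows "strict r (f \<otimes> x) (f \<otimes> y)"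
proof -
  have "x \<in> carrier \<Gamma>" "y \<in> carrier \<Gamma>"
    using assms linear_order unfolding order_on_defs by auto
  then show ?thesis using assms left_invariant by simp
qed

lemma (in ordered_group) coset_convex:
  assumes H: "subgroup H \<Gamma>" "order_convex \<Gamma> r H" and A: "A \<in> lcosets\<^bsub>\<Gamma>\<^esub> H"
    and xz: "x \<in> A" "z \<in> A" and y: "y \<in> carrier \<Gamma>" "strict r x y" "strict r y z"
  shows "y \<in> A"
proof -
  interpret H: subgroup H \<Gamma> by fact
  obtain a where a: "a \<in> carrier \<Gamma>" "A = a <# H" using A by (auto simp: LCOSETS_def)
  have "inv a \<otimes> x \<in> H" "inv a \<otimes> z \<in> H"
    using H.lcos_module_imp[OF is_group] a xz by auto
  moreover have "strict r (inv a \<otimes> x) (inv a \<otimes> y)" "strict r (inv a \<otimes> y) (inv a \<otimes> z)"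
    using strict_left_mult[of "inv a"] a y by auto
  ultimately have "inv a \<otimes> y \<in> H"
    using H(2) a y unfolding order_convex_def by blast
  then show ?thesis using H.lcos_module_rev[OF is_group] a y by auto
qed

text \<open>The two phrasings of the coset order, by some or by all pairs of representatives, agree.\<close>

lemma (in ordered_group) coset_less_all:
  assumes H: "subgroup H \<Gamma>" "order_convex \<Gamma> r H"
    and A: "A \<in> lcosets\<^bsub>\<Gamma>\<^esub> H" and B: "B \<in> lcosets\<^bsub>\<Gamma>\<^esub> H" and "A \<noteq> B"
    and ab: "a \<in> A" "b \<in> B" "strict r a b" and xy: "x \<in> A" "y \<in> B"
  shows "strict r x y"
proof -
  have disj: "A \<inter> B = {}" using lcos_disjoint[OF H(1)] A B \<open>A \<noteq> B\<close> by blast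
  have sub: "A \<subseteq> carrier \<Gamma>" "B \<subseteq> carrier \<Gamma>"
    using subgroup.lcosets_carrier[OF H(1) is_group] A B by auto
  have xb: "strict r x b"
  proof (rule ccontr)
    assume "\<not> strict r x b"
    then have "strict r b x" using strict_linear disj sub ab xy by blast
    then show False using coset_convex[OF H A] ab xy disj sub by blast
  qed
  show ?thesis
  proof (rule ccontr)
    assume "\<not> strict r x y"
    then have "strict r y x" using strict_linear disj sub ab xy by blast
    then show False using coset_convex[OF H B] xb ab xy disj sub by blast
  qed
qed

lemma (in ordered_group) coset_linear_order:
  assumes H: "subgroup H \<Gamma>" "order_convex \<Gamma> r H"
  shows "linear_order_on (lcosets\<^bsub>\<Gamma>\<^esub> H) (coset_order \<Gamma> r H)"
proof -
  interpret H: subgroup H \<Gamma> by fact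
  note all = coset_less_all[OF H]
  have ne: "\<exists>a. a \<in> A \<and> a \<in> carrier \<Gamma>" if A: "A \<in> lcosets\<^bsub>\<Gamma>\<^esub> H" for A
  proof -
    obtain a where "a \<in> carrier \<Gamma>" "A = a <# H" using A by (auto simp: LCOSETS_def)
    then show ?thesis using lcos_self[OF _ H(1)] by auto
  qed
  have irr: "\<not> (strict r x y \<and> strict r y x)" for x y
    using strict_trans[of x y x] by blast
  have "refl_on (lcosets\<^bsub>\<Gamma>\<^esub> H) (coset_order \<Gamma> r H)"
    "coset_order \<Gamma> r H \<subseteq> (lcosets\<^bsub>\<Gamma>\<^esub> H) \<times> (lcosets\<^bsub>\<Gamma>\<^esub> H)"
    by (auto simp: coset_order_def refl_on_def)
  moreover have "antisym (coset_order \<Gamma> r H)"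
  proof (rule antisymI, rule ccontr)
    fix A B assume *: "(A, B) \<in> coset_order \<Gamma> r H" "(B, A) \<in> coset_order \<Gamma> r H" "A \<noteq> B"
    then obtain a b where ab: "a \<in> A" "b \<in> B" "strict r a b" by (auto simp: coset_order_def)
    from * obtain c d where cd: "c \<in> B" "d \<in> A" "strict r c d" by (auto simp: coset_order_def)
    have "strict r b a" using all[of B A c d b a] ab cd * by (auto simp: coset_order_def)
    then show False using irr ab by blast
  qed
  moreover have "trans (coset_order \<Gamma> r H)"
  proof (rule transI)
    fix A B C assume *: "(A, B) \<in> coset_order \<Gamma> r H" "(B, C) \<in> coset_order \<Gamma> r H"
    show "(A, C) \<in> coset_order \<Gamma> r H"
    proof (cases "A = B \<or> B = C")
      case True
      then show ?thesis using * by auto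
    next
      case False
      then obtain a b where ab: "a \<in> A" "b \<in> B" "strict r a b"
        using * by (auto simp: coset_order_def)
      from * False obtain c d where cd: "c \<in> B" "d \<in> C" "strict r c d"
        by (auto simp: coset_order_def)
      have "strict r b d" using all[of B C c d b d] ab cd * False by (auto simp: coset_order_def)
      then have "strict r a d" using ab strict_trans by blast
      then show ?thesis using * ab cd by (auto simp: coset_order_def)
    qed
  qed
  moreover have "total_on (lcosets\<^bsub>\<Gamma>\<^esub> H) (coset_order \<Gamma> r H)"
  proof (rule total_onI)
    fix A B assume *: "A \<in> lcosets\<^bsub>\<Gamma>\<^esub> H" "B \<in> lcosets\<^bsub>\<Gamma>\<^esub> H" "A \<noteq> B"
    obtain a b where ab: "a \<in> A" "b \<in> B" "a \<in> carrier \<Gamma>" "b \<in> carrier \<Gamma>"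
      using ne * by metis
    have "a \<noteq> b" using lcos_disjoint[OF H(1) *] ab by auto
    then have "strict r a b \<or> strict r b a" using strict_linear ab by blast
    then show "(A, B) \<in> coset_order \<Gamma> r H \<or> (B, A) \<in> coset_order \<Gamma> r H"
      using * ab unfolding coset_order_def by blast
  qed
  ultimately show ?thesis unfolding order_on_defs by blast
qed

lemma (in ordered_group) coset_ordered_action:
  assumes H: "subgroup H \<Gamma>" "order_convex \<Gamma> r H"
  shows "ordered_action \<Gamma> (lcosets\<^bsub>\<Gamma>\<^esub> H) (coset_action \<Gamma> H) (coset_order \<Gamma> r H)"
proof -
  interpret H: subgroup H \<Gamma> by fact
  let ?\<Omega> = "lcosets\<^bsub>\<Gamma>\<^esub> H"
  have closed: "g <# A \<in> ?\<Omega>" if "g \<in> carrier \<Gamma>" "A \<in> ?\<Omega>" for g A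
    using that by (auto simp: LCOSETS_def lcos_m_assoc H.subset)
  have sub: "A \<subseteq> carrier \<Gamma>" if "A \<in> ?\<Omega>" for A
    using H.lcosets_carrier[OF is_group that] .
  have bij: "coset_action \<Gamma> H g \<in> Bij ?\<Omega>" if g: "g \<in> carrier \<Gamma>" for g
  proof -
    have "bij_betw (\<lambda>C. g <# C) ?\<Omega> ?\<Omega>"
      by (rule bij_betwI[where g = "\<lambda>C. inv g <# C"])
        (use g closed sub in \<open>auto simp: lcos_m_assoc lcos_mult_one\<close>)
    then show ?thesis by (simp add: Bij_def coset_action_def cong: bij_betw_cong)
  qed
  have "coset_action \<Gamma> H (g \<otimes> h) = compose ?\<Omega> (coset_action \<Gamma> H g) (coset_action \<Gamma> H h)"
    if "g \<in> carrier \<Gamma>" "h \<in> carrier \<Gamma>" for g h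
    using that closed sub by (auto simp: coset_action_def compose_def lcos_m_assoc fun_eq_iff)
  then have "coset_action \<Gamma> H \<in> hom \<Gamma> (BijGroup ?\<Omega>)"
    using bij by (auto simp: hom_def BijGroup_def)
  then have "group_action \<Gamma> ?\<Omega> (coset_action \<Gamma> H)"
    by (simp add: group_action_def group_hom_def group_hom_axioms_def group_BijGroup is_group)
  moreover have "(coset_action \<Gamma> H g A, coset_action \<Gamma> H g B) \<in> coset_order \<Gamma> r H"
    if g: "g \<in> carrier \<Gamma>" and AB: "(A, B) \<in> coset_order \<Gamma> r H" for g A B
  proof -
    have *: "A \<in> ?\<Omega>" "B \<in> ?\<Omega>" using AB by (auto simp: coset_order_def)
    have "g <# A = g <# B \<or> (\<exists>x\<in>g <# A. \<exists>y\<in>g <# B. strict r x y)"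
    proof (cases "A = B")
      case False
      then obtain a b where "a \<in> A" "b \<in> B" "strict r a b" using AB by (auto simp: coset_order_def)
      then have "g \<otimes> a \<in> g <# A" "g \<otimes> b \<in> g <# B" "strict r (g \<otimes> a) (g \<otimes> b)"
        using strict_left_mult[OF g] by (auto simp: l_coset_def)
      then show ?thesis by blast
    qed simp
    then show ?thesis using * closed[OF g] by (simp add: coset_order_def coset_action_def)
  qed
  ultimately show ?thesis
    using coset_linear_order[OF H]
    by (simp add: ordered_action_def ordered_action_axioms_def)
qed

text \<open>In a convex jump, the relation \<^term>\<open>r\<close> need not be restricted to \<^term>\<open>G\<close> first.\<close>

lemma convex_jump_ordered_action:
  assumes "ordered_group \<Gamma> r" "convex_jump \<Gamma> r G H"
  shows "ordered_action (\<Gamma>\<lparr>carrier := G\<rparr>) (lcosets\<^bsub>\<Gamma>\<lparr>carrier := G\<rparr>\<^esub> H)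
    (coset_action (\<Gamma>\<lparr>carrier := G\<rparr>) H) (coset_order (\<Gamma>\<lparr>carrier := G\<rparr>) r H)"
proof -
  interpret \<Gamma>: ordered_group \<Gamma> r by fact
  let ?G = "\<Gamma>\<lparr>carrier := G\<rparr>" and ?s = "r \<inter> G \<times> G"
  have G: "subgroup G \<Gamma>" and H: "subgroup H \<Gamma>" "order_convex \<Gamma> r H" "H \<subseteq> G"
    using assms(2) by (auto simp: convex_jump_def convex_subgroup_def)
  interpret G: ordered_group ?G ?s
    using ordered_group_subgroup[OF assms(1) G] .
  have HG: "subgroup H ?G"
    using \<Gamma>.subgroup_incl[OF H(1) G H(3)] .
  have "order_convex ?G ?s H"
    unfolding order_convex_def
  proof (intro ballI impI)
    fix f1 f2 f assume "f1 \<in> H" "f2 \<in> H" "f \<in> carrier ?G" "strict ?s f1 f \<and> strict ?s f f2"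
    moreover from this have "f \<in> carrier \<Gamma>" using subgroup.subset[OF G] by auto
    ultimately show "f \<in> H" using H(2) unfolding order_convex_def by blast
  qed
  then have "ordered_action ?G (lcosets\<^bsub>?G\<^esub> H) (coset_action ?G H) (coset_order ?G ?s H)"
    using G.coset_ordered_action HG by blast
  moreover have "coset_order ?G ?s H = coset_order ?G r H"
  proof -
    have sub: "A \<subseteq> G" if "A \<in> lcosets\<^bsub>?G\<^esub> H" for A
      using subgroup.lcosets_carrier[OF HG G.is_group that] by simp
    have eq: "(\<exists>a\<in>A. \<exists>b\<in>B. strict ?s a b) \<longleftrightarrow> (\<exists>a\<in>A. \<exists>b\<in>B. strict r a b)"
      if "A \<in> lcosets\<^bsub>?G\<^esub> H" "B \<in> lcosets\<^bsub>?G\<^esub> H" for A B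
      using sub[OF that(1)] sub[OF that(2)] by blast
    have "(A, B) \<in> coset_order ?G ?s H \<longleftrightarrow> (A, B) \<in> coset_order ?G r H" for A B
      unfolding coset_order_def mem_Collect_eq case_prod_conv using eq[of A B] by argo
    then show ?thesis by (intro subset_antisym subrelI) blast+
  qed
  ultimately show ?thesis by simp
qed

definition conradian_extension ::
    "('a, 'm) monoid_scheme \<Rightarrow> ('a \<times> 'a) set \<Rightarrow> 'a set \<Rightarrow> bool"
  where "conradian_extension G r H \<longleftrightarrow>
    (\<nexists>f g u v w. crossing G (lcosets\<^bsub>G\<^esub> H) (coset_action G H) (coset_order G r H) f g u v w)"

definition real_group :: "real monoid"
  where "real_group = \<lparr>carrier = UNIV, monoid.mult = (+), one = 0\<rparr>"

definition jump_hom ::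
    "('a, 'm) monoid_scheme \<Rightarrow> ('a \<times> 'a) set \<Rightarrow> 'a set \<Rightarrow> ('a \<Rightarrow> real) \<Rightarrow> bool"
  where "jump_hom G r H \<tau> \<longleftrightarrow>
    \<tau> \<in> hom G real_group \<and> (\<exists>g\<in>carrier G. \<tau> g \<noteq> 0) \<and>
    kernel G real_group \<tau> = H \<and>
    (\<forall>g\<in>carrier G - H. positive G r g \<longrightarrow> \<tau> g > 0)"

end

theory Submission
  imports Defs
begin

text \<open>
The proof shows that the order of \<open>G/H\<close> is archimedean and then measures \<^term>\<open>G\<close> by it, in the
manner of Hoelder's theorem. Normality of \<^term>\<open>H\<close> comes out at the end, with \<^term>\<open>H\<close> a kernel.

\<^emph>\<open>Archimedean.\<close> Let \<^term>\<open>g\<close> move the base point \<^term>\<open>H\<close> of \<open>G/H\<close> upwards and let \<open>I\<close> be the convex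
hull of the orbit of the base point under the powers of \<^term>\<open>g\<close>. If some \<open>f\<close> mapped one point of
\<open>I\<close> into \<open>I\<close> and another one out of it, then \<open>I\<close> and \<open>f I\<close> would be linked or properly nested,
and either position yields a crossing built from \<^term>\<open>g\<close> and \<open>f\<close> (\<open>crossing_if_escapes_above\<close>,
\<open>orbit_hull_invariant\<close>). So a group element that maps one point of \<open>I\<close> into \<open>I\<close> preserves \<open>I\<close>.
The elements that send the base point into \<open>I\<close> therefore form a subgroup. It is convex, contains
\<^term>\<open>H\<close> properly, and so equals \<^term>\<open>G\<close> because \<open>(G, H)\<close> is a jump (\<open>orbit_in_hull\<close>). Thus the orbit
of the base point under \<^term>\<open>g\<close> is cofinal and coinitial in \<open>G/H\<close>.

\<^emph>\<open>Invariance.\<close> Comparing \<open>f\<close> and \<open>g\<close> by the order of the cosets \<open>f H\<close> and \<open>g H\<close> gives a left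
invariant archimedean total preorder on \<^term>\<open>G\<close>, and the archimedean property makes it invariant on
the right as well (\<open>cone_conjugate\<close>).

\<^emph>\<open>Measuring.\<close> Fix a strictly positive element \<open>e\<close>. The fractions \<open>m / n\<close> for which the \<open>m\<close>-th
power of \<open>e\<close> is at most the \<open>n\<close>-th power of \<open>f\<close> form a Dedekind cut, whose real number is \<open>\<tau> f\<close>.
It is additive because the powers of a product lie between the two products of powers
(\<open>slope_mult\<close>). A homomorphism with the required signs is monotone for the preorder, so it
defines the same cut after scaling to the value \<open>1\<close> at \<open>e\<close>. This is uniqueness
(\<open>additive_eq_slope\<close>).
\<close>

section \<open>Slopes in archimedean preordered groups\<close>

lemma (in group) pow_conjugate:
  assumes "f \<in> carrier G" "g \<in> carrier G"
  shows "(f \<otimes> g \<otimes> inv f) [^] (n::nat) = f \<otimes> g [^] n \<otimes> inv f"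
proof (induction n)
  case 0
  then show ?case using assms by simp
next
  case (Suc n)
  have "inv f \<otimes> (f \<otimes> x) = x" if "x \<in> carrier G" for x
    using that assms by (simp flip: m_assoc)
  then show ?case using assms Suc by (simp add: m_assoc)
qed

text \<open>Such a \<^term>\<open>Q\<close> is the set of elements \<open>\<ge> \<one>\<close> of a left invariant total preorder, so the elements
that lie in \<^term>\<open>Q\<close> together with their inverses form a subgroup; here it will be \<^term>\<open>H\<close>, and the
preorder is the one that the order of \<open>G/H\<close> induces on \<^term>\<open>G\<close>. Since invariance is on one side
only, boundedness above and below by powers of \<^term>\<open>g\<close> are separate requirements: the bound above,
applied to \<open>inv f\<close>, puts \<open>f \<otimes> g [^] n\<close> and not \<open>g [^] n \<otimes> f\<close> into \<^term>\<open>Q\<close>.\<close>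

locale archimedean_cone = group G for G (structure) +
  fixes Q :: "'a set"
  assumes cone_subset: "Q \<subseteq> carrier G"
    and cone_mult: "\<lbrakk>x \<in> Q; y \<in> Q\<rbrakk> \<Longrightarrow> x \<otimes> y \<in> Q"
    and cone_total: "x \<in> carrier G \<Longrightarrow> x \<in> Q \<or> inv x \<in> Q"
    and archimedean_above:
      "\<lbrakk>g \<in> Q; inv g \<notin> Q; f \<in> carrier G\<rbrakk> \<Longrightarrow> \<exists>n::nat. inv f \<otimes> g [^] n \<in> Q"
    and archimedean_below:
      "\<lbrakk>g \<in> Q; inv g \<notin> Q; f \<in> carrier G\<rbrakk> \<Longrightarrow> \<exists>n::nat. g [^] n \<otimes> f \<in> Q"
begin

definition cone_le :: "'a \<Rightarrow> 'a \<Rightarrow> bool"  (infix \<open>\<preceq>\<close> 50)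
  where "x \<preceq> y \<longleftrightarrow> inv x \<otimes> y \<in> Q"

lemma cone_closed: "x \<in> Q \<Longrightarrow> x \<in> carrier G"
  using cone_subset by blast

lemma one_in_cone: "\<one> \<in> Q"
  using cone_total[of \<one>] by simp

lemma cone_pow: "x \<in> Q \<Longrightarrow> x [^] (n::nat) \<in> Q"
  by (induction n) (auto simp: one_in_cone cone_mult)

text \<open>Being archimedean forces the preorder to be invariant on both sides. Suppose that \<^term>\<open>g\<close> is in the
cone and its conjugate by \<^term>\<open>f\<close> is not. Then the inverse \<open>k\<close> of that conjugate is strictly
positive, and its powers must exceed \<^term>\<open>f\<close> and, inverted, fall below \<^term>\<open>f\<close>. As
\<open>k [^] n \<otimes> f = f \<otimes> inv (g [^] n)\<close>, and \<open>inv (g [^] n)\<close> only pushes downwards, this makes both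
\<^term>\<open>f\<close> and \<open>inv f\<close> members of the cone. But then so is the product \<open>f \<otimes> g \<otimes> inv f\<close>.\<close>

lemma cone_conjugate:
  assumes g: "g \<in> Q" and f: "f \<in> carrier G"
  shows "f \<otimes> g \<otimes> inv f \<in> Q"
proof (rule ccontr)
  let ?k = "f \<otimes> inv g \<otimes> inv f"
  assume neg: "f \<otimes> g \<otimes> inv f \<notin> Q"
  have gc: "g \<in> carrier G" using g cone_closed by blast
  have inv_k: "inv ?k = f \<otimes> g \<otimes> inv f" using f gc by (simp add: inv_mult_group m_assoc)
  have k: "?k \<in> Q" "inv ?k \<notin> Q"
    using cone_total[of "f \<otimes> g \<otimes> inv f"] neg f gc inv_k
    by (auto simp: inv_mult_group m_assoc)
  have pow: "?k [^] n = f \<otimes> inv (g [^] n) \<otimes> inv f" for n :: nat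
    using pow_conjugate[OF f, of "inv g" n] gc by (simp add: nat_pow_inv)
  obtain m :: nat where m: "inv f \<otimes> ?k [^] m \<in> Q" using archimedean_above[OF k f] by blast
  have "inv f \<otimes> ?k [^] m = inv (g [^] m) \<otimes> inv f"
    unfolding pow using f gc by (simp add: m_assoc[symmetric])
  then have "g [^] m \<otimes> (inv (g [^] m) \<otimes> inv f) \<in> Q"
    using m cone_mult cone_pow[OF g] by metis
  then have f1: "inv f \<in> Q" using f gc by (simp add: m_assoc[symmetric])
  obtain n :: nat where n: "?k [^] n \<otimes> f \<in> Q" using archimedean_below[OF k f] by blast
  have "?k [^] n \<otimes> f = f \<otimes> inv (g [^] n)"
    unfolding pow using f gc by (simp add: m_assoc)
  then have "f \<otimes> inv (g [^] n) \<otimes> g [^] n \<in> Q" using n cone_mult cone_pow[OF g] by metis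
  then have "f \<in> Q" using f gc by (simp add: m_assoc)
  then show False using neg f1 g cone_mult by blast
qed

lemma le_refl: "x \<in> carrier G \<Longrightarrow> x \<preceq> x"
  by (simp add: cone_le_def one_in_cone)

lemma le_trans:
  assumes "x \<in> carrier G" "y \<in> carrier G" "z \<in> carrier G" "x \<preceq> y" "y \<preceq> z"
  shows "x \<preceq> z"
proof -
  have "inv x \<otimes> y \<otimes> (inv y \<otimes> z) = inv x \<otimes> (y \<otimes> inv y) \<otimes> z"
    using assms(1-3) by (simp only: m_assoc inv_closed m_closed)
  then show ?thesis using assms cone_mult[of "inv x \<otimes> y" "inv y \<otimes> z"] by (simp add: cone_le_def)
qed

lemma le_total: "x \<in> carrier G \<Longrightarrow> y \<in> carrier G \<Longrightarrow> x \<preceq> y \<or> y \<preceq> x"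
  using cone_total[of "inv x \<otimes> y"] by (auto simp: cone_le_def inv_mult_group)

lemma le_mult:
  assumes c: "x \<in> carrier G" "y \<in> carrier G" "z \<in> carrier G" "w \<in> carrier G"
    and "x \<preceq> y" "z \<preceq> w"
  shows "x \<otimes> z \<preceq> y \<otimes> w"
proof -
  have "inv z \<otimes> (inv x \<otimes> y) \<otimes> z \<in> Q"
    using cone_conjugate[of "inv x \<otimes> y" "inv z"] assms by (simp add: cone_le_def)
  moreover have "inv (x \<otimes> z) \<otimes> (y \<otimes> w) = inv z \<otimes> (inv x \<otimes> y) \<otimes> z \<otimes> (inv z \<otimes> w)"
  proof -
    have "z \<otimes> (inv z \<otimes> w) = w" using c by (simp flip: m_assoc)
    then show ?thesis using c by (simp add: inv_mult_group m_assoc)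
  qed
  ultimately show ?thesis using assms cone_mult by (simp add: cone_le_def)
qed

lemma le_pow:
  assumes "x \<in> carrier G" "y \<in> carrier G" "x \<preceq> y"
  shows "x [^] (n::nat) \<preceq> y [^] n"
  by (induction n) (auto simp: assms le_refl le_mult)

end

text \<open>This is the point of Hoelder's theorem where commutativity is replaced by an order argument. The
relation is left abstract so that the lemma serves a preorder and its converse, according to
which of \<open>f \<otimes> h\<close> and \<open>h \<otimes> f\<close> is the larger.\<close>

lemma (in group) pow_mult_sandwich:
  assumes refl: "\<And>x. x \<in> carrier G \<Longrightarrow> R x x"
    and trans: "\<And>x y z. \<lbrakk>x \<in> carrier G; y \<in> carrier G; z \<in> carrier G; R x y; R y z\<rbrakk> \<Longrightarrow> R x z"
    and mult: "\<And>x y z w. \<lbrakk>x \<in> carrier G; y \<in> carrier G; z \<in> carrier G; w \<in> carrier G; R x y; R z w\<rbrakk>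
      \<Longrightarrow> R (x \<otimes> z) (y \<otimes> w)"
    and f: "f \<in> carrier G" and h: "h \<in> carrier G" and swap: "R (f \<otimes> h) (h \<otimes> f)"
  shows "R (f [^] n \<otimes> h [^] n) ((f \<otimes> h) [^] (n::nat)) \<and> R ((f \<otimes> h) [^] n) (h [^] n \<otimes> f [^] n)"
proof -
  have fh: "R (f [^] n \<otimes> h) (h \<otimes> f [^] n)" for n :: nat
  proof (induction n)
    case 0
    then show ?case using refl h by simp
  next
    case (Suc n)
    have "R (f [^] n \<otimes> (f \<otimes> h)) (f [^] n \<otimes> (h \<otimes> f))" using f h swap refl mult by simp
    moreover have "R (f [^] n \<otimes> h \<otimes> f) (h \<otimes> f [^] n \<otimes> f)" using f h Suc refl mult by simp
    ultimately have "R (f [^] n \<otimes> (f \<otimes> h)) (h \<otimes> f [^] n \<otimes> f)"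
      using f h trans[of "f [^] n \<otimes> (f \<otimes> h)" "f [^] n \<otimes> (h \<otimes> f)" "h \<otimes> f [^] n \<otimes> f"]
      by (simp add: m_assoc)
    then show ?case using f h by (simp add: m_assoc)
  qed
  have hf: "R (f \<otimes> h [^] n) (h [^] n \<otimes> f)" for n :: nat
  proof (induction n)
    case 0
    then show ?case using refl f by simp
  next
    case (Suc n)
    have "R (f \<otimes> h [^] n \<otimes> h) (h [^] n \<otimes> f \<otimes> h)" using f h Suc refl mult by simp
    moreover have "R (h [^] n \<otimes> (f \<otimes> h)) (h [^] n \<otimes> (h \<otimes> f))" using f h swap refl mult by simp
    ultimately have "R (f \<otimes> h [^] n \<otimes> h) (h [^] n \<otimes> (h \<otimes> f))"
      using f h trans[of "f \<otimes> h [^] n \<otimes> h" "h [^] n \<otimes> f \<otimes> h" "h [^] n \<otimes> (h \<otimes> f)"]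
      by (simp add: m_assoc)
    then show ?case using f h by (simp add: m_assoc)
  qed
  show ?thesis
  proof (induction n)
    case 0
    then show ?case using refl by simp
  next
    case (Suc n)
    let ?p = "(f \<otimes> h) [^] n \<otimes> (f \<otimes> h)"
    have "R (f [^] n \<otimes> (f \<otimes> h [^] n) \<otimes> h) (f [^] n \<otimes> (h [^] n \<otimes> f) \<otimes> h)"
      using f h hf refl mult by simp
    moreover have "R (f [^] n \<otimes> h [^] n \<otimes> (f \<otimes> h)) ?p"
      using f h Suc refl mult by simp
    ultimately have "R (f [^] n \<otimes> (f \<otimes> h [^] n) \<otimes> h) ?p"
      using f h trans[of "f [^] n \<otimes> (f \<otimes> h [^] n) \<otimes> h" "f [^] n \<otimes> h [^] n \<otimes> (f \<otimes> h)" ?p]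
      by (simp add: m_assoc)
    moreover have "R (h [^] n \<otimes> (f [^] n \<otimes> (f \<otimes> h))) (h [^] n \<otimes> (h \<otimes> (f [^] n \<otimes> f)))"
      using f h fh[of "Suc n"] refl mult by (simp add: m_assoc)
    moreover have "R ?p (h [^] n \<otimes> f [^] n \<otimes> (f \<otimes> h))"
      using f h Suc refl mult by simp
    ultimately show ?case
      using f h trans[of ?p "h [^] n \<otimes> f [^] n \<otimes> (f \<otimes> h)" "h [^] n \<otimes> (h \<otimes> (f [^] n \<otimes> f))"]
      by (simp add: m_assoc)
  qed
qed

lemma real_eq_if_multiples_close:
  assumes "\<And>n::nat. n \<ge> 1 \<Longrightarrow> \<bar>real n * (x - y)\<bar> \<le> C"
  shows "x = y"
proof (rule ccontr)
  assume "x \<noteq> y"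
  then obtain n :: nat where n: "C < real n * \<bar>x - y\<bar>" using reals_Archimedean3[of "\<bar>x - y\<bar>"] by auto
  have "real n * \<bar>x - y\<bar> \<le> real (Suc n) * \<bar>x - y\<bar>" by (intro mult_right_mono) auto
  then show False using n assms[of "Suc n"] by (simp add: abs_mult)
qed

text \<open>A strictly positive element is fixed as the unit against which all others are measured.\<close>

locale archimedean_cone_unit = archimedean_cone +
  fixes e
  assumes unit: "e \<in> Q" "inv e \<notin> Q"
begin

lemma unit_closed: "e \<in> carrier G"
  using unit cone_closed by blast

lemma unit_pow_le_iff: "e [^] (m::int) \<preceq> e [^] (l::int) \<longleftrightarrow> m \<le> l"
proof -
  have *: "e [^] m \<preceq> e [^] l \<longleftrightarrow> e [^] (l - m) \<in> Q"
    using unit_closed int_pow_mult[of e "-m" l] by (simp add: cone_le_def int_pow_neg)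
  show ?thesis
  proof (cases "m \<le> l")
    case True
    then obtain j where "l - m = int j" using zero_le_imp_eq_int[of "l - m"] by auto
    then show ?thesis using True * cone_pow unit by (simp add: int_pow_int)
  next
    case False
    define j where "j = nat (m - l) - 1"
    have j: "l - m = - int (Suc j)" using False by (simp add: j_def)
    have "e [^] (l - m) \<notin> Q"
    proof
      assume "e [^] (l - m) \<in> Q"
      then have "e [^] (l - m) \<otimes> e [^] j \<in> Q" using cone_mult cone_pow unit by blast
      moreover have "e [^] (l - m) \<otimes> e [^] j = e [^] (- 1 :: int)"
        using unit_closed int_pow_mult[of e "l - m" "int j"] j by (simp add: int_pow_int)
      ultimately show False using unit unit_closed by (simp add: int_pow_neg)
    qed
    then show ?thesis using False * by simp
  qed
qed

text \<open>The archimedean property bounds the exponents \<open>m\<close> with \<open>e [^] m \<preceq> f\<close> on both sides, so there is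
a largest one.\<close>

lemma unit_pow_floor:
  assumes "f \<in> carrier G"
  obtains a :: int where "e [^] a \<preceq> f" "f \<preceq> e [^] (a + 1)"
proof -
  obtain n :: nat where "e [^] n \<otimes> f \<in> Q" using archimedean_below unit assms by blast
  then have lo: "e [^] (- int n) \<preceq> f"
    using unit_closed assms by (simp add: cone_le_def int_pow_neg int_pow_int)
  obtain k :: nat where "inv f \<otimes> e [^] k \<in> Q" using archimedean_above unit assms by blast
  then have hi: "f \<preceq> e [^] int k" by (simp add: cone_le_def int_pow_int)
  have "\<exists>a::int. e [^] a \<preceq> f \<and> \<not> e [^] (a + 1) \<preceq> f"
  proof (rule ccontr)
    assume contra: "\<not> ?thesis"
    have "e [^] (- int n + int j) \<preceq> f" for j
    proof (induction j)
      case (Suc j)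
      then have "e [^] (- int n + int j + 1) \<preceq> f" using contra by blast
      then show ?case by (simp add: algebra_simps)
    qed (use lo in simp)
    from this[of "n + k + 1"] have "e [^] (int k + 1) \<preceq> f" by (simp add: add.commute)
    then have "e [^] (int k + 1) \<preceq> e [^] int k"
      using hi le_trans unit_closed assms int_pow_closed by metis
    then show False by (simp add: unit_pow_le_iff)
  qed
  then show ?thesis using that le_total assms unit_closed int_pow_closed by metis
qed

text \<open>Raising the two hypotheses to the powers \<^term>\<open>k\<close> and \<^term>\<open>n\<close> compares both with \<open>f [^] (n * k)\<close>. Hence
every fraction \<open>m / n\<close> below \<^term>\<open>f\<close> is at most every fraction \<open>l / k\<close> above it.\<close>

lemma unit_pow_cut:
  assumes f: "f \<in> carrier G" and "e [^] (m::int) \<preceq> f [^] (n::nat)" "f [^] (k::nat) \<preceq> e [^] (l::int)"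
  shows "m * int k \<le> l * int n"
proof -
  note c = unit_closed f int_pow_closed nat_pow_closed
  have "e [^] (m * int k) \<preceq> f [^] (n * k)"
    using le_pow[OF _ _ assms(2), of k] c by (simp add: nat_pow_pow int_pow_pow flip: int_pow_int)
  moreover have "f [^] (n * k) \<preceq> e [^] (l * int n)"
    using le_pow[OF _ _ assms(3), of n] c
    by (simp add: nat_pow_pow int_pow_pow mult.commute flip: int_pow_int)
  ultimately have "e [^] (m * int k) \<preceq> e [^] (l * int n)"
    using c le_trans[of "e [^] (m * int k)" "f [^] (n * k)" "e [^] (l * int n)"] by simp
  then show ?thesis by (simp add: unit_pow_le_iff)
qed

text \<open>The real number whose Dedekind cut consists of the fractions \<open>m / n\<close> with \<open>e [^] m \<preceq> f [^] n\<close>.\<close>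

definition slope :: "'a \<Rightarrow> real"
  where "slope f = Sup {of_int m / of_nat n | (m::int) (n::nat). n \<ge> 1 \<and> e [^] m \<preceq> f [^] n}"

lemma
  assumes f: "f \<in> carrier G" and n: "n \<ge> 1"
  shows slope_ge: "e [^] (m::int) \<preceq> f [^] (n::nat) \<Longrightarrow> m \<le> n * slope f"
    and slope_le: "f [^] n \<preceq> e [^] m \<Longrightarrow> n * slope f \<le> m"
proof -
  let ?S = "{of_int m / of_nat n | (m::int) (n::nat). n \<ge> 1 \<and> e [^] m \<preceq> f [^] n} :: real set"
  have ub: "x \<le> of_int l / of_nat k" if k: "k \<ge> 1" "f [^] k \<preceq> e [^] l" and x: "x \<in> ?S"
    for x and k :: nat and l :: int
  proof -
    obtain p q where pq: "x = of_int p / of_nat q" "q \<ge> 1" "e [^] p \<preceq> f [^] (q::nat)"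
      using x by auto
    have "p * int k \<le> l * int q" using unit_pow_cut[OF f pq(3) k(2)] .
    then have "of_int p * real k \<le> of_int l * real q"
      by (metis of_int_le_iff of_int_mult of_int_of_nat_eq)
    then show ?thesis using pq k(1) by (simp add: pos_divide_le_eq pos_le_divide_eq)
  qed
  obtain a where a: "e [^] (a::int) \<preceq> f" "f \<preceq> e [^] (a + 1)" using unit_pow_floor[OF f] .
  have mem: "of_int a / of_nat 1 \<in> ?S" using a f by (auto intro!: exI[of _ a] exI[of _ "1::nat"])
  have bdd: "bdd_above ?S" using ub[of 1 "a + 1"] a f by (intro bdd_aboveI) auto
  show "m \<le> n * slope f" if "e [^] m \<preceq> f [^] n"
  proof -
    have "of_int m / of_nat n \<le> slope f"
      unfolding slope_def using that n by (intro cSup_upper bdd) auto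
    then show ?thesis using n by (simp add: field_simps)
  qed
  show "n * slope f \<le> m" if "f [^] n \<preceq> e [^] m"
  proof -
    have "slope f \<le> of_int m / of_nat n"
      unfolding slope_def using mem ub[OF n that] by (intro cSup_least) auto
    then show ?thesis using n by (simp add: field_simps)
  qed
qed

text \<open>A number compatible with the cut of \<^term>\<open>f\<close> has its \<^term>\<open>n\<close>-fold multiple in the same unit interval
\<open>[a, a + 1]\<close> as the slope, for every \<^term>\<open>n\<close>.\<close>

lemma slope_unique:
  assumes f: "f \<in> carrier G"
    and lo: "\<And>m n. e [^] (m::int) \<preceq> f [^] (n::nat) \<Longrightarrow> m \<le> n * t"
    and hi: "\<And>m n. f [^] (n::nat) \<preceq> e [^] (m::int) \<Longrightarrow> n * t \<le> m"
  shows "t = slope f"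
proof (rule real_eq_if_multiples_close[where C = 1])
  fix n :: nat assume n: "n \<ge> 1"
  obtain a where a: "e [^] (a::int) \<preceq> f [^] n" "f [^] n \<preceq> e [^] (a + 1)"
    using unit_pow_floor[of "f [^] n"] f by auto
  show "\<bar>real n * (t - slope f)\<bar> \<le> 1"
    using lo[OF a(1)] hi[OF a(2)] slope_ge[OF f n a(1)] slope_le[OF f n a(2)]
    by (simp add: abs_le_iff algebra_simps)
qed

text \<open>The powers \<open>(f \<otimes> h) [^] n\<close> lie between \<open>f [^] n \<otimes> h [^] n\<close> and \<open>h [^] n \<otimes> f [^] n\<close>. Both of
these lie between \<open>e [^] (a + b)\<close> and \<open>e [^] (a + b + 2)\<close> when \<open>a\<close> and \<open>b\<close> are the integer parts
of \<open>f [^] n\<close> and \<open>h [^] n\<close>. So the defect of additivity is at most \<open>2 / n\<close> for every \<open>n\<close>.\<close>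

lemma slope_mult:
  assumes f: "f \<in> carrier G" and h: "h \<in> carrier G"
  shows "slope (f \<otimes> h) = slope f + slope h"
proof (rule real_eq_if_multiples_close[where C = 2])
  fix n :: nat assume n: "n \<ge> 1"
  obtain a where a: "e [^] (a::int) \<preceq> f [^] n" "f [^] n \<preceq> e [^] (a + 1)"
    using unit_pow_floor[of "f [^] n"] f by auto
  obtain b where b: "e [^] (b::int) \<preceq> h [^] n" "h [^] n \<preceq> e [^] (b + 1)"
    using unit_pow_floor[of "h [^] n"] h by auto
  let ?p = "(f \<otimes> h) [^] n" and ?x = "f [^] n \<otimes> h [^] n" and ?y = "h [^] n \<otimes> f [^] n"
  have c: "?p \<in> carrier G" "?x \<in> carrier G" "?y \<in> carrier G" using f h by auto
  have E: "e [^] (m::int) \<in> carrier G" for m using unit_closed by simp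
  have x: "e [^] (a + b) \<preceq> ?x" "?x \<preceq> e [^] (a + b + 2)"
    and y: "e [^] (a + b) \<preceq> ?y" "?y \<preceq> e [^] (a + b + 2)"
    using le_mult[OF _ _ _ _ a(1) b(1)] le_mult[OF _ _ _ _ a(2) b(2)]
      le_mult[OF _ _ _ _ b(1) a(1)] le_mult[OF _ _ _ _ b(2) a(2)] f h unit_closed
    by (simp_all add: int_pow_mult[symmetric] add.commute add.left_commute)
  have "(?x \<preceq> ?p \<and> ?p \<preceq> ?y) \<or> (?y \<preceq> ?p \<and> ?p \<preceq> ?x)"
  proof (cases "f \<otimes> h \<preceq> h \<otimes> f")
    case True
    then show ?thesis
      by (intro disjI1 pow_mult_sandwich[where R = "(\<preceq>)"] f h)
        (auto intro: le_refl le_mult le_trans)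
  next
    case False
    then have "h \<otimes> f \<preceq> f \<otimes> h" using le_total f h by blast
    then have "?p \<preceq> ?x \<and> ?y \<preceq> ?p"
      by (intro pow_mult_sandwich[where R = "\<lambda>x y. y \<preceq> x"] f h)
        (auto intro: le_refl le_mult le_trans)
    then show ?thesis by blast
  qed
  then have "e [^] (a + b) \<preceq> ?p" "?p \<preceq> e [^] (a + b + 2)"
    using x y c E le_trans by meson+
  then show "\<bar>real n * (slope (f \<otimes> h) - (slope f + slope h))\<bar> \<le> 2"
    using slope_ge[of "f \<otimes> h" n "a + b"] slope_le[of "f \<otimes> h" n "a + b + 2"] f h
      slope_ge[OF f n a(1)] slope_le[OF f n a(2)] slope_ge[OF h n b(1)] slope_le[OF h n b(2)] n
    by (simp add: abs_le_iff algebra_simps)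
qed

lemma slope_nonneg: "f \<in> Q \<Longrightarrow> 0 \<le> slope f"
  using slope_ge[of f 1 0] cone_closed by (simp add: cone_le_def)

lemma slope_inv:
  assumes "f \<in> carrier G"
  shows "slope (inv f) = - slope f"
proof -
  have "slope (\<one> \<otimes> \<one>) = slope \<one> + slope \<one>" by (rule slope_mult) auto
  then show ?thesis using slope_mult[of f "inv f"] assms by simp
qed

lemma slope_pos:
  assumes "f \<in> Q" "inv f \<notin> Q"
  shows "0 < slope f"
proof -
  have fc: "f \<in> carrier G" using assms cone_closed by blast
  obtain n :: nat where "inv e \<otimes> f [^] n \<in> Q"
    using archimedean_above assms unit_closed by blast
  then have n: "e [^] (1::int) \<preceq> f [^] n" using unit_closed by (simp add: cone_le_def)
  have "n \<noteq> 0"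
  proof
    assume "n = 0"
    then show False using n unit unit_closed by (simp add: cone_le_def)
  qed
  then have "1 \<le> n * slope f" using slope_ge[OF fc _ n] by simp
  then show ?thesis by (smt (verit) mult_nonneg_nonpos of_nat_0_le_iff)
qed

text \<open>An additive map that is nonnegative on the cone is monotone, so after division by its value at
the unit it is compatible with the cut that defines the slope.\<close>

lemma additive_eq_slope:
  assumes mult: "\<And>x y. x \<in> carrier G \<Longrightarrow> y \<in> carrier G \<Longrightarrow> \<tau> (x \<otimes> y) = \<tau> x + (\<tau> y :: real)"
    and nonneg: "\<And>x. x \<in> Q \<Longrightarrow> 0 \<le> \<tau> x" and pos: "0 < \<tau> e"
    and f: "f \<in> carrier G"
  shows "\<tau> f = \<tau> e * slope f"
proof -
  have one: "\<tau> \<one> = 0" using mult[of \<one> \<one>] by simp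
  have inv: "\<tau> (inv x) = - \<tau> x" if "x \<in> carrier G" for x
    using mult[of x "inv x"] that one by simp
  have pow: "\<tau> (x [^] n) = n * \<tau> x" if "x \<in> carrier G" for x and n :: nat
    by (induction n) (auto simp: that one mult algebra_simps)
  have int_pow: "\<tau> (e [^] m) = m * \<tau> e" for m :: int
    by (cases m rule: int_cases2) (use unit_closed pow inv in \<open>auto simp: int_pow_int int_pow_neg\<close>)
  have mono: "\<tau> x \<le> \<tau> y" if "x \<in> carrier G" "y \<in> carrier G" "x \<preceq> y" for x y
    using nonneg[of "inv x \<otimes> y"] that mult inv by (simp add: cone_le_def)
  have "\<tau> f / \<tau> e = slope f"
  proof (rule slope_unique[OF f])
    fix m :: int and n :: nat
    show "m \<le> n * (\<tau> f / \<tau> e)" if "e [^] m \<preceq> f [^] n"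
      using mono[OF _ _ that] unit_closed f pos by (simp add: pow int_pow field_simps)
    show "n * (\<tau> f / \<tau> e) \<le> m" if "f [^] n \<preceq> e [^] m"
      using mono[OF _ _ that] unit_closed f pos by (simp add: pow int_pow field_simps)
  qed
  then show ?thesis using pos by (simp add: field_simps)
qed

end

section \<open>Actions on ordered sets without crossings\<close>

text \<open>The convex hull of the orbit of \<^term>\<open>x\<close> under the cyclic group generated by \<^term>\<open>g\<close>. The two exponents
are independent integers, which makes the set unchanged when the order is reversed and \<^term>\<open>g\<close>
inverted.\<close>

definition orbit_hull ::
    "('a, 'm) monoid_scheme \<Rightarrow> 'b set \<Rightarrow> ('a \<Rightarrow> 'b \<Rightarrow> 'b) \<Rightarrow> ('b \<times> 'b) set \<Rightarrow> 'a \<Rightarrow> 'b \<Rightarrow> 'b set"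
  where "orbit_hull G \<Omega> \<phi> r g x =
    {y \<in> \<Omega>. \<exists>(m::int) (n::int). (\<phi> (g [^]\<^bsub>G\<^esub> m) x, y) \<in> r \<and> (y, \<phi> (g [^]\<^bsub>G\<^esub> n) x) \<in> r}"

context ordered_action
begin

interpretation group G
  using group_hom group_hom.axioms(1) by blast

lemma order_closed: "(x, y) \<in> r \<Longrightarrow> x \<in> \<Omega> \<and> y \<in> \<Omega>"
  using linear_order unfolding order_on_defs by auto

lemma order_refl: "x \<in> \<Omega> \<Longrightarrow> (x, x) \<in> r"
  using linear_order unfolding order_on_defs refl_on_def by auto

lemma order_trans: "(x, y) \<in> r \<Longrightarrow> (y, z) \<in> r \<Longrightarrow> (x, z) \<in> r"
  using linear_order unfolding order_on_defs by (auto dest: transD)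

lemma order_antisym: "(x, y) \<in> r \<Longrightarrow> (y, x) \<in> r \<Longrightarrow> x = y"
  using linear_order unfolding order_on_defs by (auto dest: antisymD)

lemma not_strict: "x \<in> \<Omega> \<Longrightarrow> y \<in> \<Omega> \<Longrightarrow> \<not> strict r x y \<Longrightarrow> (y, x) \<in> r"
  using linear_order order_refl unfolding order_on_defs total_on_def by metis

lemma strict_le_trans: "strict r x y \<Longrightarrow> (y, z) \<in> r \<Longrightarrow> strict r x z"
  using order_trans order_antisym by metis

lemma le_strict_trans: "(x, y) \<in> r \<Longrightarrow> strict r y z \<Longrightarrow> strict r x z"
  using order_trans order_antisym by metis

lemma act_closed: "g \<in> carrier G \<Longrightarrow> x \<in> \<Omega> \<Longrightarrow> \<phi> g x \<in> \<Omega>"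
  using element_image by blast

lemma act_one: "x \<in> \<Omega> \<Longrightarrow> \<phi> \<one> x = x"
  using id_eq_one by (metis restrict_apply')

lemma act_inv:
  "g \<in> carrier G \<Longrightarrow> x \<in> \<Omega> \<Longrightarrow> \<phi> (inv g) (\<phi> g x) = x"
  "g \<in> carrier G \<Longrightarrow> x \<in> \<Omega> \<Longrightarrow> \<phi> g (\<phi> (inv g) x) = x"
  by (simp_all add: act_one flip: composition_rule)

lemma act_le_iff:
  assumes "g \<in> carrier G" "x \<in> \<Omega>" "y \<in> \<Omega>"
  shows "(\<phi> g x, \<phi> g y) \<in> r \<longleftrightarrow> (x, y) \<in> r"
  using assms order_preserving[of g x y] order_preserving[of "inv g" "\<phi> g x" "\<phi> g y"]
  by (auto simp: act_inv)

lemma act_eq_iff: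
  assumes "g \<in> carrier G" "x \<in> \<Omega>" "y \<in> \<Omega>"
  shows "\<phi> g x = \<phi> g y \<longleftrightarrow> x = y"
  using assms inj_prop by (auto dest: inj_onD)

lemma act_inv_strict:
  assumes g: "g \<in> carrier G" and x: "strict r x (\<phi> g x)"
  shows "strict r (\<phi> (inv g) x) x"
proof -
  have xc: "x \<in> \<Omega>" using x order_closed by blast
  have "(\<phi> (inv g) x, \<phi> (inv g) (\<phi> g x)) \<in> r \<and> \<phi> (inv g) x \<noteq> \<phi> (inv g) (\<phi> g x)"
    using x xc g act_closed[OF g xc] act_le_iff[of "inv g"] act_eq_iff[of "inv g"]
    by (simp del: act_inv)
  then show ?thesis using act_inv(1)[OF g xc] by simp
qed

lemma act_pow_strict_mono:
  assumes g: "g \<in> carrier G" and x: "strict r x (\<phi> g x)" and mn: "(m::int) < n"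
  shows "strict r (\<phi> (g [^] m) x) (\<phi> (g [^] n) x)"
proof -
  have xc: "x \<in> \<Omega>" using x order_closed by blast
  have succ: "strict r (\<phi> (g [^] k) x) (\<phi> (g [^] (k + 1)) x)" for k :: int
    using x xc g act_closed[OF g xc]
    by (simp add: int_pow_mult composition_rule act_le_iff act_eq_iff)
  show ?thesis
    using mn
  proof (induction n rule: int_gr_induct)
    case base
    show ?case using succ .
  next
    case (step i)
    then show ?case using succ strict_le_trans by blast
  qed
qed

text \<open>A fixed element \<^term>\<open>g\<close> moves a point \<^term>\<open>x\<close> upwards. Then \<^term>\<open>g\<close> preserves the hull \<^term>\<open>I\<close> of the orbit
of \<^term>\<open>x\<close>, and its powers carry any point of \<^term>\<open>I\<close> beyond any other.\<close>

context
  fixes g x I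
  assumes g: "g \<in> carrier G" and moves: "strict r x (\<phi> g x)"
  defines "I \<equiv> orbit_hull G \<Omega> \<phi> r g x"
begin

lemma base_closed: "x \<in> \<Omega>"
  using moves order_closed by blast

lemma base_in_hull: "x \<in> I"
  using base_closed order_refl act_one unfolding I_def orbit_hull_def
  by (auto intro!: exI[of _ "0::int"])

lemma hull_closed: "y \<in> I \<Longrightarrow> y \<in> \<Omega>"
  by (auto simp: I_def orbit_hull_def)

lemma hull_pow:
  assumes "y \<in> I"
  shows "\<phi> (g [^] (k::int)) y \<in> I"
proof -
  obtain m n :: int where mn: "(\<phi> (g [^] m) x, y) \<in> r" "(y, \<phi> (g [^] n) x) \<in> r" and y: "y \<in> \<Omega>"
    using assms by (auto simp: I_def orbit_hull_def)
  have "(\<phi> (g [^] (k + m)) x, \<phi> (g [^] k) y) \<in> r \<and> (\<phi> (g [^] k) y, \<phi> (g [^] (k + n)) x) \<in> r"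
    using mn y g base_closed by (simp add: int_pow_mult composition_rule act_le_iff act_closed)
  then show ?thesis using act_closed g y unfolding I_def orbit_hull_def by blast
qed

lemma hull_nat_pow: "y \<in> I \<Longrightarrow> \<phi> (g [^] (n::nat)) y \<in> I"
  using hull_pow[of y "int n"] by (simp add: int_pow_int)

lemma hull_nat_pow_inv: "y \<in> I \<Longrightarrow> \<phi> (inv g [^] (n::nat)) y \<in> I"
  using hull_pow[of y "- int n"] g by (simp add: int_pow_neg_int nat_pow_inv)

lemma hull_pow_overtakes:
  assumes "y \<in> I" "z \<in> I"
  obtains n :: nat where "n \<ge> 1" "strict r y (\<phi> (g [^] n) z)"
proof -
  obtain a where a: "(y, \<phi> (g [^] (a::int)) x) \<in> r" using assms by (auto simp: I_def orbit_hull_def)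
  obtain b where b: "(\<phi> (g [^] (b::int)) x, z) \<in> r" and z: "z \<in> \<Omega>"
    using assms by (auto simp: I_def orbit_hull_def)
  define n where "n = nat (a - b) + 1"
  have "strict r (\<phi> (g [^] a) x) (\<phi> (g [^] (int n + b)) x)"
    by (rule act_pow_strict_mono[OF g moves]) (auto simp: n_def)
  moreover have "(\<phi> (g [^] (int n + b)) x, \<phi> (g [^] n) z) \<in> r"
    using b z g base_closed
    by (simp add: int_pow_mult composition_rule act_le_iff act_closed int_pow_int)
  ultimately have "strict r y (\<phi> (g [^] n) z)" using a strict_le_trans le_strict_trans by blast
  then show ?thesis using that[of n] by (simp add: n_def)
qed

lemma hull_pow_inv_undercuts:
  assumes "y \<in> I" "z \<in> I"
  obtains n :: nat where "n \<ge> 1" "strict r (\<phi> (inv g [^] n) y) z"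
proof -
  obtain n :: nat where n: "n \<ge> 1" "strict r y (\<phi> (g [^] n) z)"
    using hull_pow_overtakes[OF assms] .
  have yz: "y \<in> \<Omega>" "z \<in> \<Omega>" using assms hull_closed by auto
  have "strict r (\<phi> (inv (g [^] n)) y) (\<phi> (inv (g [^] n)) (\<phi> (g [^] n) z))"
    using n(2) yz g by (simp add: act_le_iff act_eq_iff act_closed del: act_inv)
  then show ?thesis using that[of n] n(1) g yz by (simp add: act_inv nat_pow_inv)
qed

lemma hull_convex:
  assumes "a \<in> I" "b \<in> I" "(a, y) \<in> r" "(y, b) \<in> r"
  shows "y \<in> I"
proof -
  have "y \<in> \<Omega>" using assms order_closed by blast
  then show ?thesis using assms order_trans unfolding I_def orbit_hull_def by blast
qed

lemma outside_hull:
  assumes "y \<in> \<Omega>" "y \<notin> I"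
  shows "(\<forall>z\<in>I. strict r z y) \<or> (\<forall>z\<in>I. strict r y z)"
proof (rule ccontr)
  assume "\<not> ?thesis"
  then obtain a b where "a \<in> I" "\<not> strict r a y" "b \<in> I" "\<not> strict r y b" by blast
  then have "(y, a) \<in> r" "(b, y) \<in> r" "a \<in> I" "b \<in> I"
    using not_strict hull_closed assms by blast+
  then show False using hull_convex assms by blast
qed

text \<open>Here \<open>f\<close> maps one point of the convex set \<^term>\<open>I\<close> into \<^term>\<open>I\<close> and another, \<^term>\<open>v\<close>, above it. If some
point \<open>u\<close> of \<^term>\<open>I\<close> lies below the image \<open>f I\<close>, then \<^term>\<open>I\<close> and \<open>f I\<close> are linked. The element \<^term>\<open>g\<close>
pushes \<open>u\<close> up inside \<^term>\<open>I\<close>, the inverse conjugate \<open>f \<otimes> inv g \<otimes> inv f\<close> pushes \<open>f v\<close> down inside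
\<open>f I\<close>, and they cross at the common point \<open>f y\<close>.

Otherwise \<open>f I\<close> contains \<^term>\<open>I\<close>, so \<open>inv f\<close> shrinks \<^term>\<open>I\<close> away from its upper end. Iterating
\<open>inv f\<close> on \<open>f v\<close> could still run out of \<^term>\<open>I\<close> at the lower end, so it is composed with a power of
\<^term>\<open>g\<close> that moves \<^term>\<open>x\<close> upwards. The result \<open>e\<close> keeps all iterates above \<^term>\<open>x\<close>, maps \<open>f v\<close> into
\<^term>\<open>I\<close>, and crosses with \<^term>\<open>g\<close>.\<close>

lemma crossing_if_escapes_above:
  assumes f: "f \<in> carrier G" and y: "y \<in> I" "\<phi> f y \<in> I"
    and v: "v \<in> I" and above: "\<And>z. z \<in> I \<Longrightarrow> strict r z (\<phi> f v)"
  shows "\<exists>h k u v w. crossing G \<Omega> \<phi> r h k u v w"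
proof (cases "\<exists>u\<in>I. \<forall>z\<in>I. strict r u (\<phi> f z)")
  case True
  then obtain u where u: "u \<in> I" "\<And>z. z \<in> I \<Longrightarrow> strict r u (\<phi> f z)" by blast
  let ?h = "f \<otimes> inv g \<otimes> inv f"
  have pow: "\<phi> (?h [^] n) (\<phi> f z) = \<phi> f (\<phi> (inv g [^] n) z)" if "z \<in> \<Omega>" for z and n :: nat
    using that f g by (simp add: pow_conjugate composition_rule act_closed act_inv)
  obtain M :: nat where M: "M \<ge> 1" "strict r (\<phi> f y) (\<phi> (g [^] M) u)"
    using hull_pow_overtakes[OF y(2) u(1)] .
  obtain N :: nat where N: "N \<ge> 1" "strict r (\<phi> (inv g [^] N) v) y"
    using hull_pow_inv_undercuts[OF v y(1)] .
  have "strict r (\<phi> (?h [^] N) (\<phi> f v)) (\<phi> f y)"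
    using N(2) pow v y f g hull_closed by (simp add: act_le_iff act_eq_iff act_closed)
  moreover have "strict r u (\<phi> (?h [^] n) (\<phi> f v))" for n :: nat
    using u(2)[OF hull_nat_pow_inv[OF v]] pow v hull_closed by simp
  moreover have "strict r (\<phi> (g [^] n) u) (\<phi> f v)" for n :: nat
    using above hull_nat_pow u(1) by blast
  moreover have "u \<in> \<Omega>" "\<phi> f v \<in> \<Omega>" "\<phi> f y \<in> \<Omega>" "?h \<in> carrier G"
    using u v y f g hull_closed act_closed by auto
  ultimately have "crossing G \<Omega> \<phi> r ?h g u (\<phi> f v) (\<phi> f y)"
    unfolding crossing_def using M N u(2)[OF y(1)] above[OF y(2)] g by blast
  then show ?thesis by blast
next
  case False
  have shrink: "\<phi> (inv f) z \<in> I" if z: "z \<in> I" for z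
  proof (rule ccontr)
    have zc: "z \<in> \<Omega>" "\<phi> (inv f) z \<in> \<Omega>" using z f hull_closed act_closed by auto
    assume "\<phi> (inv f) z \<notin> I"
    then consider "strict r v (\<phi> (inv f) z)" | "\<forall>t\<in>I. strict r (\<phi> (inv f) z) t"
      using outside_hull zc v by blast
    then show False
    proof cases
      case 1
      then have "strict r (\<phi> f v) z"
        using order_preserving[of f v "\<phi> (inv f) z"] f zc v hull_closed by (auto simp: act_inv)
      then show False using above[OF z] order_antisym by blast
    next
      case 2
      have "strict r z (\<phi> f t)" if "t \<in> I" for t
        using order_preserving[of f "\<phi> (inv f) z" t] 2 that f zc hull_closed
        by (auto simp: act_inv)
      then show False using False z by blast
    qed
  qed
  \<comment> \<open>This power of \<^term>\<open>g\<close> compensates a possible downward drift of \<^term>\<open>inv f\<close>.\<close>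
  obtain k :: nat where k: "strict r x (\<phi> (g [^] k) (\<phi> (inv f) x))"
    using hull_pow_overtakes[OF base_in_hull shrink[OF base_in_hull]] by blast
  let ?e = "g [^] k \<otimes> inv f" and ?u = "\<phi> (inv g) x" and ?v = "\<phi> f v"
  have c: "?e \<in> carrier G" "?u \<in> \<Omega>" "?v \<in> \<Omega>" using f g v hull_closed act_closed base_closed by auto
  have e_def: "\<phi> ?e z = \<phi> (g [^] k) (\<phi> (inv f) z)" if "z \<in> \<Omega>" for z
    using that f g by (simp add: composition_rule)
  have ev: "\<phi> ?e ?v = \<phi> (g [^] k) v"
    using e_def c(3) v f hull_closed by (simp add: act_inv)
  have evI: "\<phi> ?e ?v \<in> I" using ev hull_nat_pow[OF v] by simp
  obtain M where M: "M \<ge> 1" "strict r (\<phi> ?e ?v) (\<phi> (g [^] (M::nat)) (\<phi> ?e ?v))"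
    using hull_pow_overtakes[OF evI evI] .
  let ?w = "\<phi> (g [^] M) (\<phi> ?e ?v)"
  have w: "?w \<in> I" using hull_nat_pow evI by blast
  have uI: "?u \<in> I" using hull_nat_pow_inv[OF base_in_hull, of 1] g by simp
  have ux: "strict r ?u x"
    using act_inv_strict[OF g moves] .
  have e_up: "(x, \<phi> (?e [^] n) x) \<in> r" for n :: nat
  proof (induction n)
    case 0
    then show ?case using base_closed order_refl act_one by simp
  next
    case (Suc n)
    have "(x, \<phi> ?e x) \<in> r" using k e_def base_closed by simp
    then have "(\<phi> (?e [^] n) x, \<phi> (?e [^] n) (\<phi> ?e x)) \<in> r"
      using order_preserving[OF nat_pow_closed[OF c(1)]] by blast
    moreover have "\<phi> (?e [^] n) (\<phi> ?e x) = \<phi> (?e [^] Suc n) x"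
      using composition_rule[OF base_closed nat_pow_closed[OF c(1)] c(1)] by simp
    ultimately show ?case using Suc order_trans by metis
  qed
  have e_above: "strict r ?u (\<phi> (?e [^] n) ?v)" for n :: nat
  proof -
    have "strict r (\<phi> (?e [^] n) x) (\<phi> (?e [^] n) ?v)"
      using above[OF base_in_hull] base_closed c nat_pow_closed[OF c(1)]
      by (simp add: act_le_iff act_eq_iff)
    then show ?thesis using strict_le_trans[OF ux] e_up[of n] order_trans by blast
  qed
  have uw: "strict r ?u ?w" using strict_le_trans[OF e_above[of 1], of ?w] M(2) c by simp
  obtain L where L: "L \<ge> 1" "strict r ?w (\<phi> (g [^] (L::nat)) ?u)"
    using hull_pow_overtakes[OF w uI] .
  have "strict r (\<phi> (?e [^] (1::nat)) ?v) ?w" using M c by simp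
  moreover have "strict r (\<phi> (g [^] n) ?u) ?v" for n :: nat
    using above hull_nat_pow[OF uI] by blast
  ultimately have "crossing G \<Omega> \<phi> r ?e g ?u ?v ?w"
    unfolding crossing_def
    using c g w hull_closed uw above[OF w] e_above L by blast
  then show ?thesis by blast
qed

end

lemma ordered_action_converse: "ordered_action G \<Omega> \<phi> (r\<inverse>)"
  using linear_order order_preserving group_action_axioms
  by (simp add: ordered_action_def ordered_action_axioms_def)

lemma orbit_hull_converse:
  assumes "g \<in> carrier G"
  shows "orbit_hull G \<Omega> \<phi> (r\<inverse>) (inv g) x = orbit_hull G \<Omega> \<phi> r g x"
proof -
  have eq: "inv g [^] m = g [^] (- m)" for m :: int using assms by (simp add: int_pow_inv int_pow_neg)
  have "(\<exists>(m::int) (n::int). (y, \<phi> (inv g [^] m) x) \<in> r \<and> (\<phi> (inv g [^] n) x, y) \<in> r) \<longleftrightarrow>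
    (\<exists>(m::int) (n::int). (\<phi> (g [^] m) x, y) \<in> r \<and> (y, \<phi> (g [^] n) x) \<in> r)" for y
    unfolding eq by (metis minus_minus)
  then show ?thesis unfolding orbit_hull_def converse_iff by simp
qed

lemma crossing_converse: "crossing G \<Omega> \<phi> (r\<inverse>) f g u v w \<Longrightarrow> crossing G \<Omega> \<phi> r g f v u w"
  unfolding crossing_def converse_iff by blast

text \<open>A point of \<^term>\<open>\<Omega>\<close> outside the hull is above or below all of it. An image above gives a crossing
directly; an image below gives one for the reversed order and the inverse of \<^term>\<open>g\<close>, and a
crossing for the reversed order is a crossing for the given one with the roles exchanged.\<close>

lemma orbit_hull_invariant:
  assumes no_crossing: "\<nexists>f g u v w. crossing G \<Omega> \<phi> r f g u v w"
    and g: "g \<in> carrier G" and moves: "strict r x (\<phi> g x)"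
    and f: "f \<in> carrier G"
    and y: "y \<in> orbit_hull G \<Omega> \<phi> r g x" "\<phi> f y \<in> orbit_hull G \<Omega> \<phi> r g x"
    and v: "v \<in> orbit_hull G \<Omega> \<phi> r g x"
  shows "\<phi> f v \<in> orbit_hull G \<Omega> \<phi> r g x"
proof (rule ccontr)
  let ?I = "orbit_hull G \<Omega> \<phi> r g x"
  assume "\<phi> f v \<notin> ?I"
  moreover have "\<phi> f v \<in> \<Omega>" using v hull_closed[OF g moves] f act_closed by blast
  ultimately consider "\<forall>z\<in>?I. strict r z (\<phi> f v)" | "\<forall>z\<in>?I. strict r (\<phi> f v) z"
    using outside_hull[OF g moves] by blast
  then show False
  proof cases
    case 1
    then show False using crossing_if_escapes_above[OF g moves f y v] no_crossing by blast
  next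
    case 2
    interpret converse: ordered_action G \<Omega> \<phi> "r\<inverse>" by (rule ordered_action_converse)
    have "strict (r\<inverse>) x (\<phi> (inv g) x)"
      using act_inv_strict[OF g moves] by auto
    then have "\<exists>h k u v w. crossing G \<Omega> \<phi> (r\<inverse>) h k u v w"
      using converse.crossing_if_escapes_above[of "inv g" x f y v] y v f g 2
      by (auto simp: orbit_hull_converse)
    then show False using crossing_converse no_crossing by blast
  qed
qed

lemma hull_carriers_subgroup:
  assumes no_crossing: "\<nexists>f g u v w. crossing G \<Omega> \<phi> r f g u v w"
    and g: "g \<in> carrier G" and moves: "strict r x (\<phi> g x)"
  shows "subgroup {f \<in> carrier G. \<phi> f x \<in> orbit_hull G \<Omega> \<phi> r g x} G"
proof -
  let ?I = "orbit_hull G \<Omega> \<phi> r g x"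
  have x: "x \<in> \<Omega>" "x \<in> ?I" using moves order_closed base_in_hull[OF g moves] by auto
  note stable = orbit_hull_invariant[OF no_crossing g moves]
  show ?thesis
  proof (rule subgroupI)
    show "{f \<in> carrier G. \<phi> f x \<in> ?I} \<noteq> {}" using x by (auto intro!: exI[of _ \<one>] simp: act_one)
    fix f assume f: "f \<in> {f \<in> carrier G. \<phi> f x \<in> ?I}"
    then show "inv f \<in> {f \<in> carrier G. \<phi> f x \<in> ?I}"
      using stable[of "inv f" "\<phi> f x" x] x by (auto simp: act_inv)
    fix h assume "h \<in> {f \<in> carrier G. \<phi> f x \<in> ?I}"
    then show "f \<otimes> h \<in> {f \<in> carrier G. \<phi> f x \<in> ?I}"
      using stable[of f x "\<phi> h x"] f x by (auto simp: composition_rule)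
  qed auto
qed

end

text \<open>The order of the orbit of \<^term>\<open>x\<close>, pulled back to the group, is archimedean as soon as every
element that moves \<^term>\<open>x\<close> upwards has a cofinal and coinitial orbit.\<close>

lemma (in ordered_action) archimedean_cone_if_cofinal:
  assumes x: "x \<in> \<Omega>"
    and cofinal: "\<And>g f. \<lbrakk>g \<in> carrier G; f \<in> carrier G; strict r x (\<phi> g x)\<rbrakk>
      \<Longrightarrow> \<phi> f x \<in> orbit_hull G \<Omega> \<phi> r g x"
  shows "archimedean_cone G {g \<in> carrier G. (x, \<phi> g x) \<in> r}"
proof -
  interpret group G using group_hom group_hom.axioms(1) by blast
  have inv_le: "(x, \<phi> (inv g \<otimes> f) x) \<in> r \<longleftrightarrow> (\<phi> g x, \<phi> f x) \<in> r"
    if "g \<in> carrier G" "f \<in> carrier G" for g f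
    using act_le_iff[of g x "\<phi> (inv g \<otimes> f) x"] that x
    by (simp add: composition_rule act_closed act_inv)
  have strict: "strict r x (\<phi> g x)"
    if "g \<in> carrier G" "(x, \<phi> g x) \<in> r" "(x, \<phi> (inv g) x) \<notin> r" for g
    using that inv_le[of g \<one>] x by (metis act_one one_closed r_one inv_closed)
  let ?Q = "{g \<in> carrier G. (x, \<phi> g x) \<in> r}"
  show ?thesis
  proof
    show "?Q \<subseteq> carrier G" by blast
    show "g \<otimes> h \<in> ?Q" if "g \<in> ?Q" "h \<in> ?Q" for g h
      using that order_trans[of x "\<phi> g x"] order_preserving[of g x "\<phi> h x"] x
      by (simp add: composition_rule)
    show "g \<in> ?Q \<or> inv g \<in> ?Q" if "g \<in> carrier G" for g
      using that inv_le[of g \<one>] not_strict[of "\<phi> g x" x] x act_closed by (auto simp: act_one)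
    fix g f assume "g \<in> ?Q" "inv g \<notin> ?Q" and f: "f \<in> carrier G"
    then have g: "g \<in> carrier G" and moves: "strict r x (\<phi> g x)" using strict by auto
    note I = base_in_hull[OF g moves] cofinal[OF g f moves]
    show "\<exists>n::nat. inv f \<otimes> g [^] n \<in> ?Q"
      using hull_pow_overtakes[OF g moves I(2,1)] f g inv_le
      by (metis (mono_tags, lifting) inv_closed m_closed mem_Collect_eq nat_pow_closed)
    show "\<exists>n::nat. g [^] n \<otimes> f \<in> ?Q"
      using hull_pow_overtakes[OF g moves I] f g x composition_rule
      by (metis (mono_tags, lifting) m_closed mem_Collect_eq nat_pow_closed)
  qed
qed

section \<open>The coset space of a Conradian jump\<close>

locale conradian_jump = ordered_group +
  fixes G H
  assumes jump: "convex_jump \<Gamma> r G H"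
    and conradian: "conradian_extension (\<Gamma>\<lparr>carrier := G\<rparr>) r H"
begin

abbreviation "G' \<equiv> \<Gamma>\<lparr>carrier := G\<rparr>"
abbreviation "cosets \<equiv> lcosets\<^bsub>G'\<^esub> H"
abbreviation "act \<equiv> coset_action G' H"
abbreviation "coset_le \<equiv> coset_order G' r H"

definition cone :: "'a set"
  where "cone = {g \<in> carrier G'. (H, act g H) \<in> coset_le}"

lemma subgroups: "subgroup G \<Gamma>" "subgroup H \<Gamma>" "H \<subset> G"
  using jump by (auto simp: convex_jump_def convex_subgroup_def)

lemma group_G': "group G'"
  using subgroups(1) subgroup.subgroup_is_group is_group by blast

lemma subgroup_H: "subgroup H G'"
  using subgroup_incl subgroups by blast

interpretation G': group G' by (rule group_G')

interpretation ordered_action G' cosets act coset_le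
  using convex_jump_ordered_action ordered_group_axioms jump by blast

lemma H_coset: "H \<in> cosets"
proof -
  have "\<one>\<^bsub>G'\<^esub> <#\<^bsub>G'\<^esub> H = H"
    by (rule G'.coset_join3[OF G'.one_closed subgroup_H subgroup.one_closed[OF subgroup_H]])
  then show ?thesis unfolding LCOSETS_def using G'.one_closed by blast
qed

lemma act_H: "act g H = g <#\<^bsub>G'\<^esub> H"
  using H_coset by (simp add: coset_action_def)

lemma act_H_self: "g \<in> G \<Longrightarrow> g \<in> act g H"
  using G'.lcos_self[OF _ subgroup_H] act_H by simp

lemma act_H_eq_iff: "g \<in> G \<Longrightarrow> act g H = H \<longleftrightarrow> g \<in> H"
  using act_H_self act_H G'.coset_join3[OF _ subgroup_H] by auto

lemma coset_le_if_strict: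
  "\<lbrakk>a \<in> G; b \<in> G; strict r a b\<rbrakk> \<Longrightarrow> (act a H, act b H) \<in> coset_le"
  using act_H_self act_closed[OF _ H_coset] by (auto simp: coset_order_def)

text \<open>The elements sending the base point \<^term>\<open>H\<close> into the hull form a subgroup because there are no
crossings, and a convex one because the hull is convex. It contains \<^term>\<open>H\<close> and also \<open>g \<notin> H\<close>, so
there is nothing left for it to be in a jump but \<^term>\<open>G\<close>.\<close>

lemma orbit_in_hull:
  assumes g: "g \<in> G" and moves: "strict coset_le H (act g H)" and f: "f \<in> G"
  shows "act f H \<in> orbit_hull G' cosets act coset_le g H"
proof -
  let ?I = "orbit_hull G' cosets act coset_le g H"
  let ?K = "{f \<in> carrier G'. act f H \<in> ?I}"
  have g': "g \<in> carrier G'" using g by simp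
  have "subgroup ?K G'"
    using hull_carriers_subgroup[OF _ g' moves] conradian
    unfolding conradian_extension_def by blast
  then have "subgroup ?K \<Gamma>" using incl_subgroup[OF subgroups(1)] by blast
  moreover have "order_convex \<Gamma> r ?K"
    unfolding order_convex_def
  proof (intro ballI impI)
    fix f1 f2 f assume *: "f1 \<in> ?K" "f2 \<in> ?K" "f \<in> carrier \<Gamma>" "strict r f1 f \<and> strict r f f2"
    then have "f \<in> G" using jump unfolding convex_jump_def convex_subgroup_def order_convex_def by auto
    have "(act f1 H, act f H) \<in> coset_le" "(act f H, act f2 H) \<in> coset_le"
      using * \<open>f \<in> G\<close> by (simp_all add: coset_le_if_strict)
    then have "act f H \<in> ?I" using * by (blast intro: hull_convex[OF g' moves])
    then show "f \<in> ?K" using \<open>f \<in> G\<close> by simp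
  qed
  moreover have "H \<subset> ?K"
  proof
    show "H \<subseteq> ?K"
    proof
      fix h assume "h \<in> H"
      then have "h \<in> G" "act h H = H" using act_H_eq_iff subgroups(3) by auto
      then show "h \<in> ?K" using base_in_hull[OF g' moves] by simp
    qed
    have "g \<in> ?K" using hull_pow[OF g' moves base_in_hull[OF g' moves], of 1] G'.int_pow_1[OF g'] g by simp
    moreover have "g \<notin> H" using moves act_H_eq_iff g by auto
    ultimately show "H \<noteq> ?K" by blast
  qed
  ultimately have "\<not> ?K \<subset> G" using jump unfolding convex_jump_def convex_subgroup_def by blast
  then show ?thesis using f by auto
qed

lemma archimedean_cone: "archimedean_cone G' cone"
  unfolding cone_def using orbit_in_hull
  by (intro archimedean_cone_if_cofinal H_coset) auto

lemma cone_inv_iff: "g \<in> G \<Longrightarrow> inv\<^bsub>G'\<^esub> g \<in> cone \<longleftrightarrow> (act g H, H) \<in> coset_le"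
  using act_le_iff[of g H "act (inv\<^bsub>G'\<^esub> g) H"] act_inv(2)[OF _ H_coset, of g]
    act_closed[OF _ H_coset, of "inv\<^bsub>G'\<^esub> g"] H_coset G'.inv_closed[of g]
  unfolding cone_def by fastforce

lemma mem_H_iff:
  assumes "g \<in> G"
  shows "g \<in> H \<longleftrightarrow> g \<in> cone \<and> inv\<^bsub>G'\<^esub> g \<in> cone"
  unfolding cone_inv_iff[OF assms]
  using act_H_eq_iff assms order_refl[OF H_coset] order_antisym unfolding cone_def by fastforce

lemma cone_iff_positive:
  assumes g: "g \<in> G - H"
  shows "g \<in> cone \<longleftrightarrow> positive G' r g"
proof
  have one: "\<one> \<in> G" "act \<one> H = H" using subgroup.one_closed[OF subgroups(1)] act_one[OF H_coset] by auto
  show "g \<in> cone" if "positive G' r g"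
    using that coset_le_if_strict[of \<one> g] one g by (simp add: positive_def cone_def)
  show "positive G' r g" if "g \<in> cone"
  proof (rule ccontr)
    assume "\<not> positive G' r g"
    moreover have "g \<in> carrier \<Gamma>" "g \<noteq> \<one>" using g subgroups subgroup.subset subgroup.one_closed by blast+
    ultimately have "strict r g \<one>" using strict_linear[of \<one> g] by (auto simp: positive_def)
    then have "(act g H, H) \<in> coset_le" using coset_le_if_strict[of g \<one>] one g by simp
    then show False using that mem_H_iff cone_inv_iff g by blast
  qed
qed

lemma jump_hom_exists_unique:
  "\<exists>\<tau>. jump_hom G' r H \<tau> \<and>
    (\<forall>\<tau>'. jump_hom G' r H \<tau>' \<longrightarrow> (\<exists>c::real. c > 0 \<and> (\<forall>g\<in>G. \<tau>' g = c * \<tau> g)))"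
proof -
  interpret C: archimedean_cone G' cone by (rule archimedean_cone)
  obtain h where h: "h \<in> G" "h \<notin> H" using subgroups(3) by blast
  \<comment> \<open>An element outside \<^term>\<open>H\<close> or its inverse is strictly positive; it becomes the unit.\<close>
  define e where "e = (if h \<in> cone then h else inv\<^bsub>G'\<^esub> h)"
  have e: "e \<in> cone" "inv\<^bsub>G'\<^esub> e \<notin> cone"
    using h mem_H_iff[of h] C.cone_total[of h] G'.inv_inv[of h] unfolding e_def by auto
  have eG: "e \<in> G" and eH: "e \<notin> H" using e mem_H_iff by (auto simp: cone_def)
  interpret C: archimedean_cone_unit G' cone e
    using e by unfold_locales
  have zero_iff: "C.slope g = 0 \<longleftrightarrow> g \<in> H" if g: "g \<in> G" for g
  proof -
    have inv: "C.slope (inv\<^bsub>G'\<^esub> g) = - C.slope g" using C.slope_inv g by simp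
    have "inv\<^bsub>G'\<^esub> (inv\<^bsub>G'\<^esub> g) = g" using g by simp
    then show ?thesis
      using C.cone_total[of g] C.slope_nonneg[of g] C.slope_nonneg[of "inv\<^bsub>G'\<^esub> g"] inv
        C.slope_pos[of g] C.slope_pos[of "inv\<^bsub>G'\<^esub> g"] mem_H_iff[OF g] g by force
  qed
  have "jump_hom G' r H C.slope"
    unfolding jump_hom_def
  proof (intro conjI ballI impI)
    show "C.slope \<in> hom G' real_group"
      using C.slope_mult by (auto simp: hom_def real_group_def)
    show "\<exists>g\<in>carrier G'. C.slope g \<noteq> 0" using eG eH zero_iff by auto
    show "kernel G' real_group C.slope = H"
      using zero_iff subgroups(3) by (auto simp: kernel_def real_group_def)
    fix g assume "g \<in> carrier G' - H" "positive G' r g"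
    then show "0 < C.slope g" using C.slope_pos[of g] cone_iff_positive[of g] mem_H_iff[of g] by auto
  qed
  moreover have "\<exists>c>0. \<forall>g\<in>G. \<tau> g = c * C.slope g" if \<tau>: "jump_hom G' r H \<tau>" for \<tau>
  proof -
    have pos: "0 < \<tau> g" if "g \<in> cone" "g \<notin> H" for g
      using that \<tau> cone_iff_positive[of g] by (auto simp: jump_hom_def cone_def)
    have zero: "\<tau> g = 0" if "g \<in> H" for g
      using that \<tau> by (auto simp: jump_hom_def kernel_def real_group_def)
    have "\<tau> g = \<tau> e * C.slope g" if "g \<in> G" for g
    proof (rule C.additive_eq_slope)
      show "\<tau> (x \<otimes>\<^bsub>G'\<^esub> y) = \<tau> x + \<tau> y" if "x \<in> carrier G'" "y \<in> carrier G'" for x y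
        using \<tau> that by (auto simp: jump_hom_def hom_def real_group_def)
      show "0 \<le> \<tau> x" if "x \<in> cone" for x using pos zero that by (cases "x \<in> H") fastforce+
    qed (use pos e eH that in auto)
    then show ?thesis using pos e eH by blast
  qed
  ultimately show ?thesis by blast
qed

end

theorem corollary1p14:
  fixes \<Gamma> :: "('a, 'm) monoid_scheme" and r :: "('a \<times> 'a) set" and G H :: "'a set"
  assumes "ordered_group \<Gamma> r"
    and "convex_jump \<Gamma> r G H"
    and "conradian_extension (\<Gamma>\<lparr>carrier := G\<rparr>) r H"
  shows "\<exists>\<tau>. jump_hom (\<Gamma>\<lparr>carrier := G\<rparr>) r H \<tau> \<and>
    (\<forall>\<tau>'. jump_hom (\<Gamma>\<lparr>carrier := G\<rparr>) r H \<tau>' \<longrightarrow>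
      (\<exists>c::real. c > 0 \<and> (\<forall>g\<in>G. \<tau>' g = c * \<tau> g)))"
  using conradian_jump.jump_hom_exists_unique[of \<Gamma> r G H] assms
  by (simp add: conradian_jump_def conradian_jump_axioms_def)

end
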